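(* Let Offline be defined by a canonical augmented filtration $\mathcal G_t=\sigma(\{\xi^l:l\ge t\}\cup G_\Theta)$, and assume that the relaxed value $\varphi(t,s)$ satisfies the Bellman Inequalities with respect to $\mathcal G$ with Bellman loss $L_B$. For all $(t,s)\in[T]\times\mathcal S$ let $\mathcal Q(t,s)\subseteq\Omega$ denote the set of sample paths for which the action $\hat U^t$ taken by the RABBI policy in state $s$ at time $t$ is not a satisfying action. If $(S^t,t\in[T])$ denotes the state trajectory under the RABBI policy and $r_\varphi$ is the maximum loss of $\varphi$, then $$\mathbb E[\mathrm{Regret}]\le\mathbb E\Big[\sum_t\big(r_\varphi\mathbf 1_{\mathcal Q(t,S^t)}+\mathbf 1_{\mathcal Q(t,S^t)^c}L_B(t,S^t)\big)\Big]\le\sum_t\big(r_\varphi\Pr[\mathcal Q(t,S^t)]+\mathbb E[L_B(t,S^t)]\big).$$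
   Context: **MDP.** State space $\mathcal S$, action space $\mathcal U$, input space $\Xi$, periods $t=T,T-1,\dots,1$ ($t$ is the time-to-go), initial state $S^T$; the underlying sample space is $\Omega$. In period $t$ a random input $\xi^t\in\Xi$ is observed, then an action $u\in\mathcal U$ is chosen; in state $s$ with input $\xi$ this gives reward $\mathcal R(s,\xi,u)$ (equal to $-\infty$ if $u$ is infeasible) and next state $\mathcal T(s,\xi,u)$, both determined by $(s,\xi,u)$. The set of feasible actions is nonempty for all $(s,\xi)$ and $\sup_{s,\xi,u}\mathcal R(s,\xi,u)<\infty$. Let $\mathcal F_t=\sigma(\{\xi^\tau:\tau\ge t\})$. **Offline.** For a set of random variables $G_\Theta=(G_\theta:\theta\in\Theta)$, the canonical augmented filtration is $\mathcal G_t=\sigma(\{\xi^l:l\ge t\}\cup G_\Theta)\supseteq\mathcal F_t$, so $\mathcal G_{t-1}\supseteq\mathcal G_t$. Offline's value function is given by $V(t,s|\mathcal G_t)=\max_{u\in\mathcal U}\{\mathcal R(s,\xi^t,u)+\mathbb E[V(t-1,\mathcal T(s,\xi^t,u)|\mathcal G_{t-1})\,|\,\mathcal G_t]\}$, $V(0,\cdot)=0$. **Bellman Inequalities.** Families of random variables $\{\varphi(t,s)\}$ and $\{L_B(t,s)\}$ satisfy the Bellman Inequalities w.r.t. $\mathcal G$ if $\varphi(t,\cdot)$, $L_B(t,\cdot)$ are $\mathcal G_t$-measurable for all $t$ (written $\varphi(t,s|\mathcal G_t)$) and (1) $\mathbb E[V(T,S^T)|\mathcal G_T]\le\varphi(T,S^T|\mathcal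 G_T)$; (2) for all $s\in\mathcal S,t\in[T]$: $\varphi(t,s|\mathcal G_t)\le\max_{u\in\mathcal U}\{\mathcal R(s,\xi^t,u)+\mathbb E[\varphi(t-1,\mathcal T(s,\xi^t,u)|\mathcal G_{t-1})|\mathcal G_t]\}+L_B(t,s)$; (3) $\varphi(0,s)=0$ for all $s$. $\varphi$ is called the relaxed value and $L_B$ the Bellman loss. **Satisfying action.** An action $u$ is satisfying for state $s$ at time $t$ if $\varphi(t,s|\mathcal G_t)\le\mathcal R(s,\xi^t,u)+\mathbb E[\varphi(t-1,\mathcal T(s,\xi^t,u)|\mathcal G_{t-1})|\mathcal G_t]+L_B(t,s)$. **Maximum loss.** $r_\varphi=\max_{t,s,u:\,\mathcal R(s,\xi^t,u)>-\infty}\{\varphi(t,s|\mathcal G_t)-(\mathcal R(s,\xi^t,u)+\mathbb E[\varphi(t-1,\mathcal T(s,\xi^t,u)|\mathcal G_{t-1})|\mathcal G_t])\}$, understood as a deterministic constant bounding this quantity almost surely for all $t,s$ and feasible $u$. **RABBI policy.** The relaxed value is of the form $\varphi(t,s|\mathcal G_t)=\varphi(t,s;f_t)$ where $f_t=f_t(\xi^T,\dots,\xi^t,G_\Theta)$ and $\varphi(t,s;f)=\max_{\mathbf x\in\mathbb R^{\mathcal U\times\Xi}}\{h_t(\mathbf x;s,f):g_t(\mathbf x;s,f)\le0\}$ for given functions $f_t,h_t,g_t$. At each time $t=T,\dots,1$ in state $S^t$, the policy computes a maximizer $\mathbf y=(y_{u,\xi})$ of the optimization problem defining $\hat\varphi(t,S^t)=\varphi(t,S^t;\mathbb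 E[f_t|\mathcal F_t])$ and, given the input $\xi^t$, takes the (feasible) action $\hat U^t$ with the highest score $y_{u,\xi^t}$; it collects $\mathcal R(S^t,\xi^t,\hat U^t)$ and moves to $S^{t-1}=\mathcal T(S^t,\xi^t,\hat U^t)$. **Regret.** $\mathbb E[\mathrm{Regret}]=\mathbb E[V(T,S^T|\mathcal G_T)]-\mathbb E\big[\sum_{t=1}^T\mathcal R(S^t,\xi^t,\hat U^t)\big]$. For a random state $S^t$, $\mathbf 1_{\mathcal Q(t,S^t)}(\omega)=\mathbf 1\{\omega\in\mathcal Q(t,S^t(\omega))\}$.
   Formalization: The second inequality is proved for Bellman loss L_B ≥ 0 (it can fail for negative L_B); the first needs no sign. V(T,S^T), φ(t,S^t) and L_B(t,S^t) are assumed integrable, the data jointly measurable, and S^T deterministic. *)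

theory Defs
  imports "HOL-Probability.Probability"
begin

section \<open>Conditional expectations of random fields\<close>

text \<open>
  An expression such as \<open>E[Y z | G]\<close>, for all parameters \<open>z\<close> at once, denotes a family of random
  variables each of which is only determined up to a null set. To take suprema over \<open>z\<close> and to
  evaluate at a random \<open>z\<close> one needs a coherent choice of versions. \<open>cond_exp_field M G Z Y C\<close> says
  that \<open>C\<close> is such a choice: it is jointly measurable, and evaluating it at any \<open>G\<close>-measurable
  parameter \<open>\<zeta>\<close> (constants included) gives a version of the conditional expectation of \<open>Y \<zeta>\<close>.
  On a countable discrete parameter space every choice of versions is of this kind
  (see below); in general, integration against a regular conditional probability gives one.
\<close>

definition cond_exp_field ::
    "'w measure \<Rightarrow> 'w measure \<Rightarrow> 'z measure \<Rightarrow> ('z \<Rightarrow> 'w \<Rightarrow> real) \<Rightarrow> ('z \<Rightarrow> 'w \<Rightarrow> real) \<Rightarrow> bool" where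
  "cond_exp_field M G Z Y C \<longleftrightarrow>
     (\<lambda>(z, \<omega>). C z \<omega>) \<in> borel_measurable (Z \<Otimes>\<^sub>M G) \<and>
     (\<forall>\<zeta> \<in> measurable G Z. AE \<omega> in M. C (\<zeta> \<omega>) \<omega> = real_cond_exp M G (\<lambda>\<omega>. Y (\<zeta> \<omega>) \<omega>) \<omega>)"

lemma cond_exp_field_countable:
  assumes "prob_space M" and sub: "subalgebra M G" and cnt: "countable Z"
    and Y[measurable]: "\<And>z. z \<in> Z \<Longrightarrow> Y z \<in> borel_measurable M"
    and C[measurable]: "\<And>z. z \<in> Z \<Longrightarrow> C z \<in> borel_measurable G"
    and ver: "\<And>z. z \<in> Z \<Longrightarrow> AE \<omega> in M. C z \<omega> = real_cond_exp M G (Y z) \<omega>"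
  shows "cond_exp_field M G (count_space Z) Y C"
  unfolding cond_exp_field_def
proof (intro conjI ballI)
  interpret prob_space M by fact
  interpret finite_measure_subalgebra M G by unfold_locales (rule sub)
  show "(\<lambda>(z, \<omega>). C z \<omega>) \<in> borel_measurable (count_space Z \<Otimes>\<^sub>M G)"
    by (rule measurable_pair_measure_countable1[OF cnt]) (simp add: C)
  fix \<zeta> assume \<zeta>: "\<zeta> \<in> measurable G (count_space Z)"
  have spG: "space G = space M" using sub by (simp add: subalgebra_def)
  have \<zeta>Z: "\<zeta> \<omega> \<in> Z" if "\<omega> \<in> space M" for \<omega>
    using measurable_space[OF \<zeta>, of \<omega>] that spG by simp
  have [measurable]: "\<zeta> \<in> measurable M (count_space Z)"
    by (rule measurable_from_subalg[OF sub \<zeta>])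
  have Y\<zeta>[measurable]: "(\<lambda>\<omega>. Y (\<zeta> \<omega>) \<omega>) \<in> borel_measurable M"
    by (rule measurable_compose_countable'[where I=Z, OF _ _ cnt]) (auto simp: Y)
  have "AE \<omega> in M. \<zeta> \<omega> = z \<longrightarrow> C (\<zeta> \<omega>) \<omega> = real_cond_exp M G (\<lambda>\<omega>. Y (\<zeta> \<omega>) \<omega>) \<omega>"
    if z: "z \<in> Z" for z
  proof -
    define f :: "_ \<Rightarrow> ennreal" where "f = indicator (\<zeta> -` {z} \<inter> space M)"
    have "\<zeta> -` {z} \<inter> space G \<in> sets G" by (rule measurable_sets[OF \<zeta>]) (simp add: z)
    then have fm: "f \<in> borel_measurable G" unfolding f_def spG by simp
    have eq: "(\<lambda>x. f x * ennreal (c * Y z x)) = (\<lambda>x. f x * ennreal (c * Y (\<zeta> x) x))" for c :: real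
      by (auto simp: f_def indicator_def)
    have a: "AE x in M. f x * nn_cond_exp M G (\<lambda>x. ennreal (c * Y z x)) x
                      = f x * nn_cond_exp M G (\<lambda>x. ennreal (c * Y (\<zeta> x) x)) x" for c :: real
    proof -
      have Yz: "Y z \<in> borel_measurable M" using Y z by simp
      have m: "(\<lambda>x. ennreal (c * Y z x)) \<in> borel_measurable M"
        "(\<lambda>x. ennreal (c * Y (\<zeta> x) x)) \<in> borel_measurable M"
        using Yz Y\<zeta> by simp_all
      show ?thesis
        using nn_cond_exp_prod[OF fm m(1)] nn_cond_exp_prod[OF fm m(2)] unfolding eq by eventually_elim simp
    qed
    show ?thesis
      using a[of 1] a[of "-1"] ver[OF z] AE_space
      by eventually_elim (auto simp: f_def real_cond_exp_def)
  qed
  then have "AE \<omega> in M. \<forall>z\<in>Z. \<zeta> \<omega> = z \<longrightarrow> C (\<zeta> \<omega>) \<omega> = real_cond_exp M G (\<lambda>\<omega>. Y (\<zeta> \<omega>) \<omega>) \<omega>"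
    by (subst AE_ball_countable[OF cnt]) blast
  then show "AE \<omega> in M. C (\<zeta> \<omega>) \<omega> = real_cond_exp M G (\<lambda>\<omega>. Y (\<zeta> \<omega>) \<omega>) \<omega>"
    using AE_space by eventually_elim (auto simp: \<zeta>Z)
qed


section \<open>The decision process\<close>

text \<open>
  Time \<open>t \<in> {1..T}\<close> is the time-to-go. State, input and action spaces are the carriers of the
  measurable spaces \<open>S\<close>, \<open>X\<close>, \<open>U\<close> (discrete ones being \<open>count_space\<close>); an action \<open>u\<close> is
  infeasible in state \<open>s\<close> with input \<open>x\<close> iff \<open>R s x u = -\<infinity>\<close>.
\<close>

locale mdp = prob_space M
  for M :: "'w measure" +
  fixes S :: "'s measure" and X :: "'x measure" and U :: "'u measure"
    and T :: nat and s0 :: 's and \<xi> :: "nat \<Rightarrow> 'w \<Rightarrow> 'x"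
    and R :: "'s \<Rightarrow> 'x \<Rightarrow> 'u \<Rightarrow> ereal" and Tr :: "'s \<Rightarrow> 'x \<Rightarrow> 'u \<Rightarrow> 's"
  assumes input_measurable: "\<And>t. t \<in> {1..T} \<Longrightarrow> \<xi> t \<in> measurable M X"
    and initial_state: "s0 \<in> space S"
    and reward_measurable: "(\<lambda>(s, x, u). R s x u) \<in> borel_measurable (S \<Otimes>\<^sub>M X \<Otimes>\<^sub>M U)"
    and transition_measurable: "(\<lambda>(s, x, u). Tr s x u) \<in> measurable (S \<Otimes>\<^sub>M X \<Otimes>\<^sub>M U) S"
    and feasible_nonempty: "\<And>s x. s \<in> space S \<Longrightarrow> x \<in> space X \<Longrightarrow> \<exists>u \<in> space U. R s x u > -\<infinity>"
    and reward_bounded: "(SUP (s, x, u) \<in> space S \<times> space X \<times> space U. R s x u) < \<infinity>"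

definition online_filtration ::
    "'w measure \<Rightarrow> 'x measure \<Rightarrow> nat \<Rightarrow> (nat \<Rightarrow> 'w \<Rightarrow> 'x) \<Rightarrow> nat \<Rightarrow> 'w measure" where
  "online_filtration M X T \<xi> t = sigma (space M)
     {\<xi> l -` A \<inter> space M | l A. l \<in> {1..T} \<and> t \<le> l \<and> A \<in> sets X}"

definition canonical_filtration ::
    "'w measure \<Rightarrow> 'x measure \<Rightarrow> nat \<Rightarrow> (nat \<Rightarrow> 'w \<Rightarrow> 'x) \<Rightarrow> 'th set \<Rightarrow> ('th \<Rightarrow> 'g measure) \<Rightarrow>
     ('th \<Rightarrow> 'w \<Rightarrow> 'g) \<Rightarrow> nat \<Rightarrow> 'w measure" where
  "canonical_filtration M X T \<xi> \<Theta> N G\<Theta> t = sigma (space M)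
     ({\<xi> l -` A \<inter> space M | l A. l \<in> {1..T} \<and> t \<le> l \<and> A \<in> sets X} \<union>
      {G\<Theta> \<theta> -` A \<inter> space M | \<theta> A. \<theta> \<in> \<Theta> \<and> A \<in> sets (N \<theta>)})"

text \<open>
  \<open>next_value_version M \<G> S U T \<xi> Tr W E\<close>: for each \<open>t\<close>, the field \<open>E t s u\<close> is
  \<open>E[W(t - 1, Tr(s, \<xi>\<^sup>t, u)) | \<G>\<^sub>t]\<close>.
\<close>

definition next_value_version ::
    "'w measure \<Rightarrow> (nat \<Rightarrow> 'w measure) \<Rightarrow> 's measure \<Rightarrow> 'u measure \<Rightarrow> nat \<Rightarrow> (nat \<Rightarrow> 'w \<Rightarrow> 'x) \<Rightarrow>
     ('s \<Rightarrow> 'x \<Rightarrow> 'u \<Rightarrow> 's) \<Rightarrow> (nat \<Rightarrow> 's \<Rightarrow> 'w \<Rightarrow> real) \<Rightarrow> (nat \<Rightarrow> 's \<Rightarrow> 'u \<Rightarrow> 'w \<Rightarrow> real) \<Rightarrow> bool" where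
  "next_value_version M \<G> S U T \<xi> Tr W E \<longleftrightarrow>
     (\<forall>t \<in> {1..T}. cond_exp_field M (\<G> t) (S \<Otimes>\<^sub>M U)
        (\<lambda>(s, u) \<omega>. W (t - 1) (Tr s (\<xi> t \<omega>) u) \<omega>) (\<lambda>(s, u). E t s u))"


section \<open>Offline's value function and the Bellman Inequalities\<close>

text \<open>
  In the predicates below, \<open>EV\<close> and \<open>E\<phi>\<close> are the fields \<open>E[V(t - 1, Tr(s, \<xi>\<^sup>t, u)) | \<G>\<^sub>t]\<close> and
  \<open>E[\<phi>(t - 1, Tr(s, \<xi>\<^sup>t, u)) | \<G>\<^sub>t]\<close>. Suprema are taken in \<open>ereal\<close>.
\<close>

definition offline_value ::
    "'w measure \<Rightarrow> (nat \<Rightarrow> 'w measure) \<Rightarrow> 's measure \<Rightarrow> 'u measure \<Rightarrow> nat \<Rightarrow> (nat \<Rightarrow> 'w \<Rightarrow> 'x) \<Rightarrow>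
     ('s \<Rightarrow> 'x \<Rightarrow> 'u \<Rightarrow> ereal) \<Rightarrow> ('s \<Rightarrow> 'x \<Rightarrow> 'u \<Rightarrow> 's) \<Rightarrow>
     (nat \<Rightarrow> 's \<Rightarrow> 'w \<Rightarrow> real) \<Rightarrow> (nat \<Rightarrow> 's \<Rightarrow> 'u \<Rightarrow> 'w \<Rightarrow> real) \<Rightarrow> bool" where
  "offline_value M \<G> S U T \<xi> R Tr V EV \<longleftrightarrow>
     (\<forall>t \<in> {0..T}. (\<lambda>(s, \<omega>). V t s \<omega>) \<in> borel_measurable (S \<Otimes>\<^sub>M \<G> t)) \<and>
     next_value_version M \<G> S U T \<xi> Tr V EV \<and>
     (\<forall>s \<in> space S. \<forall>\<omega> \<in> space M. V 0 s \<omega> = 0) \<and>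
     (AE \<omega> in M. \<forall>t \<in> {1..T}. \<forall>s \<in> space S.
        ereal (V t s \<omega>) = (SUP u \<in> space U. R s (\<xi> t \<omega>) u + ereal (EV t s u \<omega>)))"

definition bellman_inequalities ::
    "'w measure \<Rightarrow> (nat \<Rightarrow> 'w measure) \<Rightarrow> 's measure \<Rightarrow> 'u measure \<Rightarrow> nat \<Rightarrow> 's \<Rightarrow> (nat \<Rightarrow> 'w \<Rightarrow> 'x) \<Rightarrow>
     ('s \<Rightarrow> 'x \<Rightarrow> 'u \<Rightarrow> ereal) \<Rightarrow> ('s \<Rightarrow> 'x \<Rightarrow> 'u \<Rightarrow> 's) \<Rightarrow> (nat \<Rightarrow> 's \<Rightarrow> 'w \<Rightarrow> real) \<Rightarrow>
     (nat \<Rightarrow> 's \<Rightarrow> 'w \<Rightarrow> real) \<Rightarrow> (nat \<Rightarrow> 's \<Rightarrow> 'u \<Rightarrow> 'w \<Rightarrow> real) \<Rightarrow> (nat \<Rightarrow> 's \<Rightarrow> 'w \<Rightarrow> real) \<Rightarrow> bool" where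
  "bellman_inequalities M \<G> S U T s0 \<xi> R Tr V \<phi> E\<phi> L \<longleftrightarrow>
     (\<forall>t \<in> {0..T}. (\<lambda>(s, \<omega>). \<phi> t s \<omega>) \<in> borel_measurable (S \<Otimes>\<^sub>M \<G> t)) \<and>
     (\<forall>t \<in> {1..T}. (\<lambda>(s, \<omega>). L t s \<omega>) \<in> borel_measurable (S \<Otimes>\<^sub>M \<G> t)) \<and>
     next_value_version M \<G> S U T \<xi> Tr \<phi> E\<phi> \<and>
     (AE \<omega> in M. real_cond_exp M (\<G> T) (V T s0) \<omega> \<le> \<phi> T s0 \<omega>) \<and>
     (\<forall>s \<in> space S. \<forall>t \<in> {1..T}. AE \<omega> in M.
        ereal (\<phi> t s \<omega>) \<le> (SUP u \<in> space U. R s (\<xi> t \<omega>) u + ereal (E\<phi> t s u \<omega>)) + ereal (L t s \<omega>)) \<and>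
     (\<forall>s \<in> space S. \<forall>\<omega> \<in> space M. \<phi> 0 s \<omega> = 0)"

definition satisfying_action ::
    "(nat \<Rightarrow> 'w \<Rightarrow> 'x) \<Rightarrow> ('s \<Rightarrow> 'x \<Rightarrow> 'u \<Rightarrow> ereal) \<Rightarrow> (nat \<Rightarrow> 's \<Rightarrow> 'w \<Rightarrow> real) \<Rightarrow>
     (nat \<Rightarrow> 's \<Rightarrow> 'u \<Rightarrow> 'w \<Rightarrow> real) \<Rightarrow> (nat \<Rightarrow> 's \<Rightarrow> 'w \<Rightarrow> real) \<Rightarrow> nat \<Rightarrow> 's \<Rightarrow> 'w \<Rightarrow> 'u \<Rightarrow> bool" where
  "satisfying_action \<xi> R \<phi> E\<phi> L t s \<omega> u \<longleftrightarrow>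
     ereal (\<phi> t s \<omega>) \<le> R s (\<xi> t \<omega>) u + ereal (E\<phi> t s u \<omega>) + ereal (L t s \<omega>)"

definition max_loss_bound ::
    "'w measure \<Rightarrow> 's measure \<Rightarrow> 'u measure \<Rightarrow> nat \<Rightarrow> (nat \<Rightarrow> 'w \<Rightarrow> 'x) \<Rightarrow> ('s \<Rightarrow> 'x \<Rightarrow> 'u \<Rightarrow> ereal) \<Rightarrow>
     (nat \<Rightarrow> 's \<Rightarrow> 'w \<Rightarrow> real) \<Rightarrow> (nat \<Rightarrow> 's \<Rightarrow> 'u \<Rightarrow> 'w \<Rightarrow> real) \<Rightarrow> real \<Rightarrow> bool" where
  "max_loss_bound M S U T \<xi> R \<phi> E\<phi> r \<longleftrightarrow>
     (AE \<omega> in M. \<forall>t \<in> {1..T}. \<forall>s \<in> space S. \<forall>u \<in> space U. R s (\<xi> t \<omega>) u > -\<infinity> \<longrightarrow>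
        ereal (\<phi> t s \<omega>) - (R s (\<xi> t \<omega>) u + ereal (E\<phi> t s u \<omega>)) \<le> ereal r)"


section \<open>The RABBI policy\<close>

text \<open>
  The parameter \<open>f\<^sub>t\<close> is vector valued with components indexed by \<open>'i\<close>, and the constraints
  \<open>g\<^sub>t \<le> 0\<close> are indexed by \<open>'k\<close>. \<open>info_param\<close> is the random variable
  \<open>f\<^sub>t(\<xi>\<^sup>T, \<dots>, \<xi>\<^sup>t, G\<^sub>\<Theta>)\<close>.
\<close>

definition info_param ::
    "nat \<Rightarrow> (nat \<Rightarrow> 'w \<Rightarrow> 'x) \<Rightarrow> 'th set \<Rightarrow> ('th \<Rightarrow> 'w \<Rightarrow> 'g) \<Rightarrow>
     (nat \<Rightarrow> (nat \<Rightarrow> 'x) \<Rightarrow> ('th \<Rightarrow> 'g) \<Rightarrow> 'i \<Rightarrow> real) \<Rightarrow> nat \<Rightarrow> 'w \<Rightarrow> 'i \<Rightarrow> real" where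
  "info_param T \<xi> \<Theta> G\<Theta> f t \<omega> = f t (\<lambda>l\<in>{t..T}. \<xi> l \<omega>) (\<lambda>\<theta>\<in>\<Theta>. G\<Theta> \<theta> \<omega>)"

definition scores ::
    "'u measure \<Rightarrow> 'x measure \<Rightarrow> (nat \<Rightarrow> ('u \<times> 'x \<Rightarrow> real) \<Rightarrow> 's \<Rightarrow> ('i \<Rightarrow> real) \<Rightarrow> 'k \<Rightarrow> real) \<Rightarrow>
     nat \<Rightarrow> 's \<Rightarrow> ('i \<Rightarrow> real) \<Rightarrow> ('u \<times> 'x \<Rightarrow> real) set" where
  "scores U X g t s p = {x \<in> (space U \<times> space X) \<rightarrow>\<^sub>E UNIV. \<forall>k. g t x s p k \<le> 0}"

definition relaxed_form ::
    "'w measure \<Rightarrow> 's measure \<Rightarrow> 'x measure \<Rightarrow> 'u measure \<Rightarrow> nat \<Rightarrow> (nat \<Rightarrow> 'w \<Rightarrow> 'x) \<Rightarrow>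
     'th set \<Rightarrow> ('th \<Rightarrow> 'g measure) \<Rightarrow> ('th \<Rightarrow> 'w \<Rightarrow> 'g) \<Rightarrow>
     (nat \<Rightarrow> (nat \<Rightarrow> 'x) \<Rightarrow> ('th \<Rightarrow> 'g) \<Rightarrow> 'i \<Rightarrow> real) \<Rightarrow>
     (nat \<Rightarrow> ('u \<times> 'x \<Rightarrow> real) \<Rightarrow> 's \<Rightarrow> ('i \<Rightarrow> real) \<Rightarrow> real) \<Rightarrow>
     (nat \<Rightarrow> ('u \<times> 'x \<Rightarrow> real) \<Rightarrow> 's \<Rightarrow> ('i \<Rightarrow> real) \<Rightarrow> 'k \<Rightarrow> real) \<Rightarrow>
     (nat \<Rightarrow> 's \<Rightarrow> 'w \<Rightarrow> real) \<Rightarrow> bool" where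
  "relaxed_form M S X U T \<xi> \<Theta> N G\<Theta> f h g \<phi> \<longleftrightarrow>
     (\<forall>t \<in> {1..T}. \<forall>i. (\<lambda>(a, b). f t a b i) \<in>
        borel_measurable ((\<Pi>\<^sub>M l\<in>{t..T}. X) \<Otimes>\<^sub>M (\<Pi>\<^sub>M \<theta>\<in>\<Theta>. N \<theta>))) \<and>
     (\<forall>t \<in> {1..T}. \<forall>s \<in> space S. AE \<omega> in M.
        ereal (\<phi> t s \<omega>) =
          (SUP x \<in> scores U X g t s (info_param T \<xi> \<Theta> G\<Theta> f t \<omega>).
             ereal (h t x s (info_param T \<xi> \<Theta> G\<Theta> f t \<omega>))))"

definition estimated_param ::
    "'w measure \<Rightarrow> 'x measure \<Rightarrow> nat \<Rightarrow> (nat \<Rightarrow> 'w \<Rightarrow> 'x) \<Rightarrow> 'th set \<Rightarrow> ('th \<Rightarrow> 'w \<Rightarrow> 'g) \<Rightarrow>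
     (nat \<Rightarrow> (nat \<Rightarrow> 'x) \<Rightarrow> ('th \<Rightarrow> 'g) \<Rightarrow> 'i \<Rightarrow> real) \<Rightarrow> nat \<Rightarrow> 'w \<Rightarrow> 'i \<Rightarrow> real" where
  "estimated_param M X T \<xi> \<Theta> G\<Theta> f t \<omega> i =
     real_cond_exp M (online_filtration M X T \<xi> t) (\<lambda>\<omega>. info_param T \<xi> \<Theta> G\<Theta> f t \<omega> i) \<omega>"

text \<open>
  \<open>Uhat t s \<omega>\<close> is the action taken in state \<open>s\<close> at time \<open>t\<close>. Ties, both between maximizers \<open>y\<close> and
  between actions of highest score, are broken arbitrarily, but without using information
  beyond \<open>\<F>\<^sub>t\<close>; scores are compared among the feasible actions.
\<close>

definition rabbi_policy ::
    "'w measure \<Rightarrow> 's measure \<Rightarrow> 'x measure \<Rightarrow> 'u measure \<Rightarrow> nat \<Rightarrow> (nat \<Rightarrow> 'w \<Rightarrow> 'x) \<Rightarrow>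
     ('s \<Rightarrow> 'x \<Rightarrow> 'u \<Rightarrow> ereal) \<Rightarrow> 'th set \<Rightarrow> ('th \<Rightarrow> 'w \<Rightarrow> 'g) \<Rightarrow>
     (nat \<Rightarrow> (nat \<Rightarrow> 'x) \<Rightarrow> ('th \<Rightarrow> 'g) \<Rightarrow> 'i \<Rightarrow> real) \<Rightarrow>
     (nat \<Rightarrow> ('u \<times> 'x \<Rightarrow> real) \<Rightarrow> 's \<Rightarrow> ('i \<Rightarrow> real) \<Rightarrow> real) \<Rightarrow>
     (nat \<Rightarrow> ('u \<times> 'x \<Rightarrow> real) \<Rightarrow> 's \<Rightarrow> ('i \<Rightarrow> real) \<Rightarrow> 'k \<Rightarrow> real) \<Rightarrow>
     (nat \<Rightarrow> 's \<Rightarrow> 'w \<Rightarrow> 'u) \<Rightarrow> bool" where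
  "rabbi_policy M S X U T \<xi> R \<Theta> G\<Theta> f h g Uhat \<longleftrightarrow>
     (\<forall>t \<in> {1..T}. (\<lambda>(s, \<omega>). Uhat t s \<omega>) \<in> measurable (S \<Otimes>\<^sub>M online_filtration M X T \<xi> t) U) \<and>
     (AE \<omega> in M. \<forall>t \<in> {1..T}. \<forall>s \<in> space S. \<exists>y.
        is_arg_max (\<lambda>x. h t x s (estimated_param M X T \<xi> \<Theta> G\<Theta> f t \<omega>))
          (\<lambda>x. x \<in> scores U X g t s (estimated_param M X T \<xi> \<Theta> G\<Theta> f t \<omega>)) y \<and>
        is_arg_max (\<lambda>u. y (u, \<xi> t \<omega>))
          (\<lambda>u. u \<in> space U \<and> R s (\<xi> t \<omega>) u > -\<infinity>) (Uhat t s \<omega>))"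

text \<open>The state after \<open>k\<close> decisions, i.e. with time-to-go \<open>T - k\<close>.\<close>

primrec state_after ::
    "nat \<Rightarrow> 's \<Rightarrow> (nat \<Rightarrow> 'w \<Rightarrow> 'x) \<Rightarrow> ('s \<Rightarrow> 'x \<Rightarrow> 'u \<Rightarrow> 's) \<Rightarrow> (nat \<Rightarrow> 's \<Rightarrow> 'w \<Rightarrow> 'u) \<Rightarrow>
     nat \<Rightarrow> 'w \<Rightarrow> 's" where
  "state_after T s0 \<xi> Tr Uhat 0 \<omega> = s0"
| "state_after T s0 \<xi> Tr Uhat (Suc k) \<omega> =
     Tr (state_after T s0 \<xi> Tr Uhat k \<omega>) (\<xi> (T - k) \<omega>)
        (Uhat (T - k) (state_after T s0 \<xi> Tr Uhat k \<omega>) \<omega>)"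

definition state ::
    "nat \<Rightarrow> 's \<Rightarrow> (nat \<Rightarrow> 'w \<Rightarrow> 'x) \<Rightarrow> ('s \<Rightarrow> 'x \<Rightarrow> 'u \<Rightarrow> 's) \<Rightarrow> (nat \<Rightarrow> 's \<Rightarrow> 'w \<Rightarrow> 'u) \<Rightarrow>
     nat \<Rightarrow> 'w \<Rightarrow> 's" where
  "state T s0 \<xi> Tr Uhat t = state_after T s0 \<xi> Tr Uhat (T - t)"

lemma state_initial: "state T s0 \<xi> Tr Uhat T \<omega> = s0"
  by (simp add: state_def)

lemma state_step:
  assumes "t \<in> {1..T}"
  shows "state T s0 \<xi> Tr Uhat (t - 1) \<omega> =
    Tr (state T s0 \<xi> Tr Uhat t \<omega>) (\<xi> t \<omega>) (Uhat t (state T s0 \<xi> Tr Uhat t \<omega>) \<omega>)"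
proof -
  have "T - (t - 1) = Suc (T - t)" "T - (T - t) = t" using assms by auto
  then show ?thesis by (simp add: state_def)
qed

definition expected_regret ::
    "'w measure \<Rightarrow> nat \<Rightarrow> 's \<Rightarrow> (nat \<Rightarrow> 'w \<Rightarrow> 'x) \<Rightarrow> ('s \<Rightarrow> 'x \<Rightarrow> 'u \<Rightarrow> ereal) \<Rightarrow>
     ('s \<Rightarrow> 'x \<Rightarrow> 'u \<Rightarrow> 's) \<Rightarrow> (nat \<Rightarrow> 's \<Rightarrow> 'w \<Rightarrow> real) \<Rightarrow> (nat \<Rightarrow> 's \<Rightarrow> 'w \<Rightarrow> 'u) \<Rightarrow> real" where
  "expected_regret M T s0 \<xi> R Tr V Uhat =
     (\<integral>\<omega>. V T s0 \<omega> \<partial>M) -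
     (\<integral>\<omega>. (\<Sum>t=1..T. real_of_ereal
        (R (state T s0 \<xi> Tr Uhat t \<omega>) (\<xi> t \<omega>) (Uhat t (state T s0 \<xi> Tr Uhat t \<omega>) \<omega>))) \<partial>M)"

definition unsatisfying_paths ::
    "'w measure \<Rightarrow> (nat \<Rightarrow> 'w \<Rightarrow> 'x) \<Rightarrow> ('s \<Rightarrow> 'x \<Rightarrow> 'u \<Rightarrow> ereal) \<Rightarrow> (nat \<Rightarrow> 's \<Rightarrow> 'w \<Rightarrow> real) \<Rightarrow>
     (nat \<Rightarrow> 's \<Rightarrow> 'u \<Rightarrow> 'w \<Rightarrow> real) \<Rightarrow> (nat \<Rightarrow> 's \<Rightarrow> 'w \<Rightarrow> real) \<Rightarrow>
     (nat \<Rightarrow> 's \<Rightarrow> 'w \<Rightarrow> 'u) \<Rightarrow> nat \<Rightarrow> 's \<Rightarrow> 'w set" where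
  "unsatisfying_paths M \<xi> R \<phi> E\<phi> L Uhat t s =
     {\<omega> \<in> space M. \<not> satisfying_action \<xi> R \<phi> E\<phi> L t s \<omega> (Uhat t s \<omega>)}"

end

theory Submission
  imports Defs
begin

text \<open>
  Follow the relaxed value along the trajectory of the policy. In one period it drops from
  \<open>\<phi>(t, S\<^sup>t)\<close> to \<open>\<phi>(t - 1, S\<^sup>t\<^sup>-\<^sup>1)\<close>, and the policy earns a reward in exchange. If the action taken
  is satisfying, the expected drop exceeds the reward by at most \<open>L(t, S\<^sup>t)\<close>, by definition; if it
  is not, the excess is still at most the maximum loss \<open>r\<close>, because the action is feasible.
  Summed over the periods the drops telescope to \<open>\<phi>(T, s0) - \<phi>(0, S\<^sup>0) = \<phi>(T, s0)\<close>, which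
  dominates Offline's value in expectation by the first Bellman inequality. This gives the first
  bound; the second one drops the indicator in front of a nonnegative \<open>L\<close>.

  Two points need care. The Bellman terms are conditional expectations at deterministic
  states and actions, whereas the telescoping sum has them at \<open>S\<^sup>t\<close> and at the action taken
  there. These are random, but known at time \<open>t\<close> (\<open>state_measurable\<close>), because the policy uses only the information in \<open>\<F>\<^sub>t\<close>, which
  \<open>\<G>\<^sub>t\<close> contains. Hence the conditional expectation field may be evaluated at them
  (\<open>cond_exp_field_at\<close>), and yields \<open>E[\<phi>(t - 1, S\<^sup>t\<^sup>-\<^sup>1) | \<G>\<^sub>t]\<close>, whose mean is that of
  \<open>\<phi>(t - 1, S\<^sup>t\<^sup>-\<^sup>1)\<close>. Moreover, the collected rewards must be integrable: they are bounded above by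
  hypothesis, and the one-period inequality itself bounds them below by an integrable variable
  (\<open>expected_rewards_lower_bound\<close>).
\<close>

section \<open>Telescoping a value process\<close>

text \<open>
  Integrating the one-period inequalities and adding them up makes the means of \<open>\<Phi>\<close> telescope.
  Splitting the mean of the total reward needs integrability of each \<open>\<rho> t\<close>, which follows because
  \<open>\<rho> t\<close> lies between the integrable \<open>\<Phi> t - C t - l t\<close> and the constant \<open>B\<close>. Each \<open>C t\<close> stands for a conditional expectation of \<open>\<Phi> (t - 1)\<close>.
\<close>

lemma (in finite_measure) expected_rewards_lower_bound:
  fixes \<Phi> C \<rho> l :: "nat \<Rightarrow> 'a \<Rightarrow> real"
  assumes \<Phi>: "\<And>t. t \<in> {1..T} \<Longrightarrow> integrable M (\<Phi> t)"
    and C: "\<And>t. t \<in> {1..T} \<Longrightarrow> integrable M (C t)"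
    and mean_C: "\<And>t. t \<in> {1..T} \<Longrightarrow> (\<integral>\<omega>. C t \<omega> \<partial>M) = (\<integral>\<omega>. \<Phi> (t - 1) \<omega> \<partial>M)"
    and l: "\<And>t. t \<in> {1..T} \<Longrightarrow> integrable M (l t)"
    and \<rho>: "\<And>t. t \<in> {1..T} \<Longrightarrow> \<rho> t \<in> borel_measurable M"
    and upper: "\<And>t. t \<in> {1..T} \<Longrightarrow> AE \<omega> in M. \<rho> t \<omega> \<le> B"
    and step: "\<And>t. t \<in> {1..T} \<Longrightarrow> AE \<omega> in M. \<Phi> t \<omega> \<le> \<rho> t \<omega> + C t \<omega> + l t \<omega>"
  shows "(\<integral>\<omega>. \<Phi> T \<omega> \<partial>M) - (\<integral>\<omega>. \<Phi> 0 \<omega> \<partial>M) - (\<integral>\<omega>. (\<Sum>t=1..T. \<rho> t \<omega>) \<partial>M)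
           \<le> (\<integral>\<omega>. (\<Sum>t=1..T. l t \<omega>) \<partial>M)"
proof -
  have int_\<rho>: "integrable M (\<rho> t)" if t: "t \<in> {1..T}" for t
  proof (rule Bochner_Integration.integrable_bound)
    show "integrable M (\<lambda>\<omega>. \<bar>B\<bar> + \<bar>\<Phi> t \<omega> - C t \<omega> - l t \<omega>\<bar>)"
      using \<Phi>[OF t] C[OF t] l[OF t] by simp
    show "AE \<omega> in M. norm (\<rho> t \<omega>) \<le> norm (\<bar>B\<bar> + \<bar>\<Phi> t \<omega> - C t \<omega> - l t \<omega>\<bar>)"
      using upper[OF t] step[OF t] by eventually_elim auto
  qed (rule \<rho>[OF t])
  have "(\<integral>\<omega>. \<Phi> t \<omega> \<partial>M) - (\<integral>\<omega>. \<Phi> (t - 1) \<omega> \<partial>M) \<le> (\<integral>\<omega>. \<rho> t \<omega> \<partial>M) + (\<integral>\<omega>. l t \<omega> \<partial>M)"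
    if t: "t \<in> {1..T}" for t
  proof -
    have "(\<integral>\<omega>. \<Phi> t \<omega> \<partial>M) \<le> (\<integral>\<omega>. \<rho> t \<omega> + C t \<omega> + l t \<omega> \<partial>M)"
      by (rule integral_mono_AE) (use \<Phi> C l int_\<rho> step t in auto)
    then show ?thesis
      using C l int_\<rho> t by (simp add: mean_C)
  qed
  then have "(\<Sum>t=1..T. (\<integral>\<omega>. \<Phi> t \<omega> \<partial>M) - (\<integral>\<omega>. \<Phi> (t - 1) \<omega> \<partial>M))
      \<le> (\<Sum>t=1..T. (\<integral>\<omega>. \<rho> t \<omega> \<partial>M) + (\<integral>\<omega>. l t \<omega> \<partial>M))"
    by (rule sum_mono)
  moreover have "(\<Sum>t=1..T. (\<integral>\<omega>. \<Phi> t \<omega> \<partial>M) - (\<integral>\<omega>. \<Phi> (t - 1) \<omega> \<partial>M))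
      = (\<integral>\<omega>. \<Phi> T \<omega> \<partial>M) - (\<integral>\<omega>. \<Phi> 0 \<omega> \<partial>M)"
    by (induction T) auto
  ultimately show ?thesis
    using int_\<rho> l by (simp add: sum.distrib)
qed

section \<open>Random fields evaluated at random parameters\<close>

lemma measurable_field_at:
  assumes C: "(\<lambda>(z, \<omega>). C z \<omega>) \<in> measurable (Z \<Otimes>\<^sub>M H) K"
    and \<zeta>: "\<zeta> \<in> measurable H Z"
  shows "(\<lambda>\<omega>. C (\<zeta> \<omega>) \<omega>) \<in> measurable H K"
  using measurable_compose[OF measurable_Pair[OF \<zeta> measurable_ident] C] by (simp add: id_def)

lemma measurable_field_mono:
  assumes sub: "subalgebra H F" and C: "C \<in> measurable (Z \<Otimes>\<^sub>M F) K"
  shows "C \<in> measurable (Z \<Otimes>\<^sub>M H) K"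
proof -
  have "(\<lambda>\<omega>. \<omega>) \<in> measurable H F"
    by (rule measurable_from_subalg[OF sub measurable_ident_sets[OF refl]])
  then have "(\<lambda>p. (fst p, snd p)) \<in> measurable (Z \<Otimes>\<^sub>M H) (Z \<Otimes>\<^sub>M F)"
    by (intro measurable_Pair measurable_fst measurable_compose[OF measurable_snd])
  from measurable_compose[OF this C] show ?thesis by simp
qed

text \<open>
  By the definition of a conditional expectation field, \<open>C\<close> at a parameter known to \<open>H\<close> is a
  version of a conditional expectation, and conditioning preserves integrability and mean.
\<close>

lemma cond_exp_field_at:
  assumes M: "prob_space M" and sub: "subalgebra M H"
    and C: "cond_exp_field M H Z Y C" and \<zeta>: "\<zeta> \<in> measurable H Z"
    and int: "integrable M (\<lambda>\<omega>. Y (\<zeta> \<omega>) \<omega>)"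
  shows "integrable M (\<lambda>\<omega>. C (\<zeta> \<omega>) \<omega>)"
    and "(\<integral>\<omega>. C (\<zeta> \<omega>) \<omega> \<partial>M) = (\<integral>\<omega>. Y (\<zeta> \<omega>) \<omega> \<partial>M)"
proof -
  interpret prob_space M by fact
  interpret finite_measure_subalgebra M H by unfold_locales (rule sub)
  have [measurable]: "(\<lambda>\<omega>. C (\<zeta> \<omega>) \<omega>) \<in> borel_measurable M"
    using C \<zeta> by (auto simp: cond_exp_field_def
        intro: measurable_from_subalg[OF sub] measurable_field_at)
  have [measurable]: "real_cond_exp M H (\<lambda>\<omega>. Y (\<zeta> \<omega>) \<omega>) \<in> borel_measurable M"
    using real_cond_exp_int(1)[OF int] by simp
  have ae: "AE \<omega> in M. C (\<zeta> \<omega>) \<omega> = real_cond_exp M H (\<lambda>\<omega>. Y (\<zeta> \<omega>) \<omega>) \<omega>"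
    using C \<zeta> by (simp add: cond_exp_field_def)
  show "integrable M (\<lambda>\<omega>. C (\<zeta> \<omega>) \<omega>)"
    using integrable_cong_AE[OF _ _ ae] real_cond_exp_int(1)[OF int] by simp
  show "(\<integral>\<omega>. C (\<zeta> \<omega>) \<omega> \<partial>M) = (\<integral>\<omega>. Y (\<zeta> \<omega>) \<omega> \<partial>M)"
    using integral_cong_AE[OF _ _ ae] real_cond_exp_int(2)[OF int] by simp
qed

section \<open>Information available along the trajectory\<close>

context mdp
begin

lemma subalgebra_canonical_filtration:
  assumes "\<And>\<theta>. \<theta> \<in> \<Theta> \<Longrightarrow> G\<Theta> \<theta> \<in> measurable M (N \<theta>)"
  shows "subalgebra M (canonical_filtration M X T \<xi> \<Theta> N G\<Theta> t)"
  unfolding subalgebra_def canonical_filtration_def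
  by (auto simp: sets_measure_of_conv space_measure_of_conv
      intro!: sets.sigma_sets_subset measurable_sets input_measurable assms)

lemma input_measurable_canonical_filtration:
  assumes "l \<in> {1..T}" "t \<le> l"
  shows "\<xi> l \<in> measurable (canonical_filtration M X T \<xi> \<Theta> N G\<Theta> t) X"
proof (rule measurableI)
  fix A assume "A \<in> sets X"
  then show "\<xi> l -` A \<inter> space (canonical_filtration M X T \<xi> \<Theta> N G\<Theta> t)
      \<in> sets (canonical_filtration M X T \<xi> \<Theta> N G\<Theta> t)"
    unfolding canonical_filtration_def using assms
    by (subst sets_measure_of) (auto simp: space_measure_of_conv intro!: sigma_sets.Basic)
qed (use measurable_space[OF input_measurable[OF assms(1)]] in
      \<open>simp add: canonical_filtration_def space_measure_of_conv\<close>)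

lemma online_subalgebra_canonical_filtration:
  assumes "t \<le> l"
  shows "subalgebra (canonical_filtration M X T \<xi> \<Theta> N G\<Theta> t) (online_filtration M X T \<xi> l)"
proof -
  have "sigma_sets (space M) {\<xi> k -` A \<inter> space M | k A. k \<in> {1..T} \<and> l \<le> k \<and> A \<in> sets X}
    \<subseteq> sigma_sets (space M)
      ({\<xi> k -` A \<inter> space M | k A. k \<in> {1..T} \<and> t \<le> k \<and> A \<in> sets X} \<union>
       {G\<Theta> \<theta> -` A \<inter> space M | \<theta> A. \<theta> \<in> \<Theta> \<and> A \<in> sets (N \<theta>)})"
    using assms by (intro sigma_sets_mono') (blast intro: order_trans)
  then show ?thesis
    unfolding subalgebra_def canonical_filtration_def online_filtration_def
    by (subst (1 2) sets_measure_of) (auto simp: space_measure_of_conv)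
qed

text \<open>
  The parameter \<open>H\<close> is the information available: the state with time-to-go \<open>t\<close> depends only on
  inputs and actions of the periods before, whose time-to-go is greater than \<open>t\<close>.
\<close>

lemma state_measurable:
  assumes \<xi>: "\<And>l. l \<in> {1..T} \<Longrightarrow> t < l \<Longrightarrow> \<xi> l \<in> measurable H X"
    and u: "\<And>l. l \<in> {1..T} \<Longrightarrow> t < l \<Longrightarrow> (\<lambda>(s, \<omega>). Uhat l s \<omega>) \<in> measurable (S \<Otimes>\<^sub>M H) U"
  shows "state T s0 \<xi> Tr Uhat t \<in> measurable H S"
proof -
  have "state_after T s0 \<xi> Tr Uhat k \<in> measurable H S" if "k \<le> T - t" for k
    using that
  proof (induction k)
    case 0
    have "state_after T s0 \<xi> Tr Uhat 0 = (\<lambda>\<omega>. s0)" by auto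
    then show ?case using initial_state by simp
  next
    case (Suc k)
    let ?s = "state_after T s0 \<xi> Tr Uhat k"
    have l: "T - k \<in> {1..T}" "t < T - k" using Suc.prems by auto
    have s: "?s \<in> measurable H S" using Suc by simp
    have "(\<lambda>\<omega>. (?s \<omega>, \<xi> (T - k) \<omega>, Uhat (T - k) (?s \<omega>) \<omega>)) \<in> measurable H (S \<Otimes>\<^sub>M X \<Otimes>\<^sub>M U)"
      by (intro measurable_Pair s \<xi>[OF l] measurable_field_at[OF u[OF l] s])
    from measurable_compose[OF this transition_measurable] show ?case by simp
  qed
  then show ?thesis by (simp add: state_def)
qed

lemma reward_upper_bound:
  obtains B :: real where
    "\<And>s x u. s \<in> space S \<Longrightarrow> x \<in> space X \<Longrightarrow> u \<in> space U \<Longrightarrow> R s x u \<le> ereal B"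
proof -
  let ?B = "SUP (s, x, u) \<in> space S \<times> space X \<times> space U. R s x u"
  obtain B where B: "?B \<le> ereal B"
    using reward_bounded by (cases ?B) auto
  show ?thesis
  proof (rule that)
    fix s x u assume "s \<in> space S" "x \<in> space X" "u \<in> space U"
    then have "R s x u \<le> ?B" by (intro SUP_upper2[where i="(s, x, u)"]) auto
    then show "R s x u \<le> ereal B" using B by (rule order_trans)
  qed
qed

end

section \<open>Regret of the policy\<close>

theorem theorem5:
  fixes M :: "'w measure" and S :: "'s measure" and X :: "'x measure" and U :: "'u measure"
    and T :: nat and s0 :: 's and \<xi> :: "nat \<Rightarrow> 'w \<Rightarrow> 'x"
    and R :: "'s \<Rightarrow> 'x \<Rightarrow> 'u \<Rightarrow> ereal" and Tr :: "'s \<Rightarrow> 'x \<Rightarrow> 'u \<Rightarrow> 's"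
    and \<Theta> :: "'th set" and N :: "'th \<Rightarrow> 'g measure" and G\<Theta> :: "'th \<Rightarrow> 'w \<Rightarrow> 'g"
    and \<G> :: "nat \<Rightarrow> 'w measure"
    and V \<phi> L :: "nat \<Rightarrow> 's \<Rightarrow> 'w \<Rightarrow> real" and EV E\<phi> :: "nat \<Rightarrow> 's \<Rightarrow> 'u \<Rightarrow> 'w \<Rightarrow> real"
    and f :: "nat \<Rightarrow> (nat \<Rightarrow> 'x) \<Rightarrow> ('th \<Rightarrow> 'g) \<Rightarrow> 'i \<Rightarrow> real"
    and h :: "nat \<Rightarrow> ('u \<times> 'x \<Rightarrow> real) \<Rightarrow> 's \<Rightarrow> ('i \<Rightarrow> real) \<Rightarrow> real"
    and g :: "nat \<Rightarrow> ('u \<times> 'x \<Rightarrow> real) \<Rightarrow> 's \<Rightarrow> ('i \<Rightarrow> real) \<Rightarrow> 'k \<Rightarrow> real"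
    and Uhat :: "nat \<Rightarrow> 's \<Rightarrow> 'w \<Rightarrow> 'u" and r :: real
    and St :: "nat \<Rightarrow> 'w \<Rightarrow> 's" and Q :: "nat \<Rightarrow> 's \<Rightarrow> 'w set"
  assumes mdp: "mdp M S X U T s0 \<xi> R Tr"
    and G\<Theta>_random_variables: "\<And>\<theta>. \<theta> \<in> \<Theta> \<Longrightarrow> G\<Theta> \<theta> \<in> measurable M (N \<theta>)"
  defines "\<G> \<equiv> canonical_filtration M X T \<xi> \<Theta> N G\<Theta>"
  assumes offline: "offline_value M \<G> S U T \<xi> R Tr V EV"
    and bellman: "bellman_inequalities M \<G> S U T s0 \<xi> R Tr V \<phi> E\<phi> L"
    and form: "relaxed_form M S X U T \<xi> \<Theta> N G\<Theta> f h g \<phi>"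
    and policy: "rabbi_policy M S X U T \<xi> R \<Theta> G\<Theta> f h g Uhat"
    and max_loss: "max_loss_bound M S U T \<xi> R \<phi> E\<phi> r"
  defines "St \<equiv> state T s0 \<xi> Tr Uhat"
    and "Q \<equiv> unsatisfying_paths M \<xi> R \<phi> E\<phi> L Uhat"
  assumes integrable_V: "integrable M (V T s0)"
    and integrable_\<phi>: "\<And>t. t \<in> {1..T} \<Longrightarrow> integrable M (\<lambda>\<omega>. \<phi> t (St t \<omega>) \<omega>)"
    and integrable_L: "\<And>t. t \<in> {1..T} \<Longrightarrow> integrable M (\<lambda>\<omega>. L t (St t \<omega>) \<omega>)"
  shows "expected_regret M T s0 \<xi> R Tr V Uhat
           \<le> (\<integral>\<omega>. (\<Sum>t=1..T. r * indicator (Q t (St t \<omega>)) \<omega>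
                            + indicator (- Q t (St t \<omega>)) \<omega> * L t (St t \<omega>) \<omega>) \<partial>M)
       \<and> ((AE \<omega> in M. \<forall>t \<in> {1..T}. \<forall>s \<in> space S. 0 \<le> L t s \<omega>) \<longrightarrow>
          (\<integral>\<omega>. (\<Sum>t=1..T. r * indicator (Q t (St t \<omega>)) \<omega>
                            + indicator (- Q t (St t \<omega>)) \<omega> * L t (St t \<omega>) \<omega>) \<partial>M)
           \<le> (\<Sum>t=1..T. r * measure M {\<omega> \<in> space M. \<omega> \<in> Q t (St t \<omega>)}
                            + (\<integral>\<omega>. L t (St t \<omega>) \<omega> \<partial>M)))"
proof -
  interpret mdp M S X U T s0 \<xi> R Tr by (rule mdp)
  have sub: "subalgebra M (\<G> t)" for t
    unfolding \<G>_def by (rule subalgebra_canonical_filtration[OF G\<Theta>_random_variables])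
  define A where "A t \<omega> = Uhat t (St t \<omega>) \<omega>" for t \<omega>
  define \<rho> where "\<rho> t \<omega> = real_of_ereal (R (St t \<omega>) (\<xi> t \<omega>) (A t \<omega>))" for t \<omega>
  define C where "C t \<omega> = E\<phi> t (St t \<omega>) (A t \<omega>) \<omega>" for t \<omega>
  define l where "l t \<omega> = r * indicator (Q t (St t \<omega>)) \<omega>
      + indicator (- Q t (St t \<omega>)) \<omega> * L t (St t \<omega>) \<omega>" for t \<omega>

  have Uhat_\<G>: "(\<lambda>(s, \<omega>). Uhat l s \<omega>) \<in> measurable (S \<Otimes>\<^sub>M \<G> t) U"
    if l: "l \<in> {1..T}" "t \<le> l" for l t
  proof (rule measurable_field_mono)
    show "subalgebra (\<G> t) (online_filtration M X T \<xi> l)"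
      unfolding \<G>_def by (rule online_subalgebra_canonical_filtration[OF l(2)])
    show "(\<lambda>(s, \<omega>). Uhat l s \<omega>) \<in> measurable (S \<Otimes>\<^sub>M online_filtration M X T \<xi> l) U"
      using policy l(1) by (simp add: rabbi_policy_def)
  qed
  have \<xi>_\<G>: "\<xi> l \<in> measurable (\<G> t) X" if "l \<in> {1..T}" "t \<le> l" for l t
    unfolding \<G>_def by (rule input_measurable_canonical_filtration[OF that])
  have St_\<G>: "St t \<in> measurable (\<G> t) S" for t
    unfolding St_def by (rule state_measurable) (auto intro: Uhat_\<G> \<xi>_\<G>)
  have A_\<G>: "A t \<in> measurable (\<G> t) U" if "t \<in> {1..T}" for t
    unfolding A_def[abs_def] using measurable_field_at[OF Uhat_\<G>[OF that order_refl] St_\<G>] by simp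
  have St_A_\<G>: "(\<lambda>\<omega>. (St t \<omega>, A t \<omega>)) \<in> measurable (\<G> t) (S \<Otimes>\<^sub>M U)" if "t \<in> {1..T}" for t
    by (intro measurable_Pair St_\<G> A_\<G> that)
  have St_M[measurable]: "St t \<in> measurable M S" for t
    by (rule measurable_from_subalg[OF sub St_\<G>])
  have St_space: "St t \<omega> \<in> space S" if "\<omega> \<in> space M" for t \<omega>
    using that by (rule measurable_space[OF St_M])
  have A_space: "A t \<omega> \<in> space U" if "t \<in> {1..T}" "\<omega> \<in> space M" for t \<omega>
    using that by (blast intro: measurable_space measurable_from_subalg[OF sub A_\<G>])

  have reward_M: "(\<lambda>\<omega>. R (St t \<omega>) (\<xi> t \<omega>) (A t \<omega>)) \<in> borel_measurable M"
    if t: "t \<in> {1..T}" for t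
  proof -
    have "(\<lambda>\<omega>. (St t \<omega>, \<xi> t \<omega>, A t \<omega>)) \<in> measurable M (S \<Otimes>\<^sub>M X \<Otimes>\<^sub>M U)"
      by (intro measurable_Pair St_M input_measurable[OF t] measurable_from_subalg[OF sub A_\<G>[OF t]])
    from measurable_compose[OF this reward_measurable] show ?thesis by simp
  qed
  obtain B where B: "\<And>s x u. s \<in> space S \<Longrightarrow> x \<in> space X \<Longrightarrow> u \<in> space U \<Longrightarrow> R s x u \<le> ereal B"
    using reward_upper_bound by blast
  have feasible: "AE \<omega> in M. \<forall>t \<in> {1..T}. R (St t \<omega>) (\<xi> t \<omega>) (A t \<omega>) = ereal (\<rho> t \<omega>) \<and> \<rho> t \<omega> \<le> B"
  proof -
    have "AE \<omega> in M. \<forall>t \<in> {1..T}. \<forall>s \<in> space S. R s (\<xi> t \<omega>) (Uhat t s \<omega>) > -\<infinity>"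
      using policy unfolding rabbi_policy_def is_arg_max_def
      by (auto elim!: eventually_mono)
    then show ?thesis
      using AE_space
    proof eventually_elim
      case (elim \<omega>)
      show ?case
      proof
        fix t assume t: "t \<in> {1..T}"
        have "R (St t \<omega>) (\<xi> t \<omega>) (A t \<omega>) > -\<infinity>"
          using elim t St_space by (simp add: A_def)
        moreover have "R (St t \<omega>) (\<xi> t \<omega>) (A t \<omega>) \<le> ereal B"
          using B[OF St_space measurable_space[OF input_measurable] A_space] t elim by simp
        ultimately show "R (St t \<omega>) (\<xi> t \<omega>) (A t \<omega>) = ereal (\<rho> t \<omega>) \<and> \<rho> t \<omega> \<le> B"
          unfolding \<rho>_def by (cases "R (St t \<omega>) (\<xi> t \<omega>) (A t \<omega>)") auto
      qed
    qed
  qed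

  have \<phi>_0: "\<phi> 0 (St 0 \<omega>) \<omega> = 0" if "\<omega> \<in> space M" for \<omega>
    using bellman that St_space by (simp add: bellman_inequalities_def)
  \<comment> \<open>At \<open>t = 0\<close> the relaxed value vanishes on the space of \<open>M\<close>, so it is integrable there too.\<close>
  have int_\<phi>: "integrable M (\<lambda>\<omega>. \<phi> t (St t \<omega>) \<omega>)" if "t \<le> T" for t
  proof (cases "t = 0")
    case True
    have "integrable M (\<lambda>\<omega>. \<phi> 0 (St 0 \<omega>) \<omega>) \<longleftrightarrow> integrable M (\<lambda>\<omega>. 0 :: real)"
      by (rule Bochner_Integration.integrable_cong) (auto simp: \<phi>_0)
    then show ?thesis using True by simp
  qed (use integrable_\<phi> that in auto)
  have field: "cond_exp_field M (\<G> t) (S \<Otimes>\<^sub>M U)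
      (\<lambda>(s, u) \<omega>. \<phi> (t - 1) (Tr s (\<xi> t \<omega>) u) \<omega>) (\<lambda>(s, u). E\<phi> t s u)" if "t \<in> {1..T}" for t
    using bellman that by (simp add: bellman_inequalities_def next_value_version_def)
  have next_state: "Tr (St t \<omega>) (\<xi> t \<omega>) (A t \<omega>) = St (t - 1) \<omega>" if "t \<in> {1..T}" for t \<omega>
    unfolding St_def A_def state_step[OF that] ..
  have C: "integrable M (C t)" "(\<integral>\<omega>. C t \<omega> \<partial>M) = (\<integral>\<omega>. \<phi> (t - 1) (St (t - 1) \<omega>) \<omega> \<partial>M)"
    if t: "t \<in> {1..T}" for t
  proof -
    have "t - 1 \<le> T" using t by simp arith
    then have i: "integrable M (\<lambda>\<omega>. (\<lambda>(s, u) \<omega>. \<phi> (t - 1) (Tr s (\<xi> t \<omega>) u) \<omega>) (St t \<omega>, A t \<omega>) \<omega>)"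
      using int_\<phi>[of "t - 1"] by (simp add: next_state[OF t])
    note at = cond_exp_field_at[OF prob_space_axioms sub field[OF t] St_A_\<G>[OF t] i]
    show "integrable M (C t)"
      using at(1) by (simp add: C_def[abs_def])
    show "(\<integral>\<omega>. C t \<omega> \<partial>M) = (\<integral>\<omega>. \<phi> (t - 1) (St (t - 1) \<omega>) \<omega> \<partial>M)"
      using at(2) by (simp add: C_def[abs_def] next_state[OF t])
  qed

  have Q_iff: "\<omega> \<in> Q t (St t \<omega>) \<longleftrightarrow> \<not> ereal (\<phi> t (St t \<omega>) \<omega>)
      \<le> R (St t \<omega>) (\<xi> t \<omega>) (A t \<omega>) + ereal (C t \<omega>) + ereal (L t (St t \<omega>) \<omega>)"
    if "\<omega> \<in> space M" for t \<omega>
    using that by (simp add: Q_def unsatisfying_paths_def satisfying_action_def A_def C_def)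
  \<comment> \<open>\<open>Q t (St t \<omega>)\<close> is a different set for each \<open>\<omega>\<close>; only this diagonal set has to be an event.\<close>
  have Q_sets: "{\<omega> \<in> space M. \<omega> \<in> Q t (St t \<omega>)} \<in> sets M" if t: "t \<in> {1..T}" for t
  proof -
    have [measurable]: "(\<lambda>\<omega>. \<phi> t (St t \<omega>) \<omega>) \<in> borel_measurable M"
        "(\<lambda>\<omega>. L t (St t \<omega>) \<omega>) \<in> borel_measurable M" "C t \<in> borel_measurable M"
        "(\<lambda>\<omega>. R (St t \<omega>) (\<xi> t \<omega>) (A t \<omega>)) \<in> borel_measurable M"
      using integrable_\<phi>[OF t] integrable_L[OF t] C(1)[OF t] reward_M[OF t] by simp_all
    have "{\<omega> \<in> space M. \<omega> \<in> Q t (St t \<omega>)} = {\<omega> \<in> space M. \<not> ereal (\<phi> t (St t \<omega>) \<omega>)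
        \<le> R (St t \<omega>) (\<xi> t \<omega>) (A t \<omega>) + ereal (C t \<omega>) + ereal (L t (St t \<omega>) \<omega>)}"
      using Q_iff by blast
    also have "\<dots> \<in> sets M" by measurable
    finally show ?thesis .
  qed
  let ?Q = "\<lambda>t. {\<omega> \<in> space M. \<omega> \<in> Q t (St t \<omega>)}"
  have l_eq: "l t \<omega> = r * indicator (?Q t) \<omega> + indicator (space M - ?Q t) \<omega> * L t (St t \<omega>) \<omega>"
    if "\<omega> \<in> space M" for t \<omega>
    using that by (auto simp: l_def indicator_def)
  have int_Q: "integrable M (\<lambda>\<omega>. r * indicator (?Q t) \<omega> :: real)" if "t \<in> {1..T}" for t
    using Q_sets[OF that] by (simp add: less_top[symmetric])
  have int_l: "integrable M (l t)" if t: "t \<in> {1..T}" for t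
  proof -
    have "integrable M (\<lambda>\<omega>. indicator (space M - ?Q t) \<omega> * L t (St t \<omega>) \<omega>)"
      using integrable_mult_indicator[OF _ integrable_L[OF t]] Q_sets[OF t] by simp
    then have "integrable M (\<lambda>\<omega>. r * indicator (?Q t) \<omega>
        + indicator (space M - ?Q t) \<omega> * L t (St t \<omega>) \<omega>)"
      by (intro Bochner_Integration.integrable_add int_Q t)
    moreover have "integrable M (l t) \<longleftrightarrow> integrable M (\<lambda>\<omega>. r * indicator (?Q t) \<omega>
        + indicator (space M - ?Q t) \<omega> * L t (St t \<omega>) \<omega>)"
      by (rule Bochner_Integration.integrable_cong) (auto simp: l_eq)
    ultimately show ?thesis by simp
  qed

  \<comment> \<open>Both cases use that the collected reward is a real number, so the extended real
    inequalities can be rearranged.\<close>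
  have step: "AE \<omega> in M. \<phi> t (St t \<omega>) \<omega> \<le> \<rho> t \<omega> + C t \<omega> + l t \<omega>" if t: "t \<in> {1..T}" for t
    using max_loss[unfolded max_loss_bound_def] feasible AE_space
  proof eventually_elim
    case (elim \<omega>)
    have R: "R (St t \<omega>) (\<xi> t \<omega>) (A t \<omega>) = ereal (\<rho> t \<omega>)" using elim t by blast
    show ?case
    proof (cases "\<omega> \<in> Q t (St t \<omega>)")
      case True
      have "ereal (\<phi> t (St t \<omega>) \<omega>) - (R (St t \<omega>) (\<xi> t \<omega>) (A t \<omega>) + ereal (C t \<omega>)) \<le> ereal r"
        unfolding C_def
        by (rule elim(1)[rule_format, OF t St_space A_space[OF t]]) (simp_all add: elim(3) R)
      then show ?thesis using True by (simp add: R l_def algebra_simps)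
    next
      case False
      then show ?thesis using Q_iff[of \<omega> t] elim by (simp add: R l_def)
    qed
  qed

  have offline_le: "(\<integral>\<omega>. V T s0 \<omega> \<partial>M) \<le> (\<integral>\<omega>. \<phi> T (St T \<omega>) \<omega> \<partial>M)"
  proof -
    interpret finite_measure_subalgebra M "\<G> T" by unfold_locales (rule sub)
    have "(\<integral>\<omega>. V T s0 \<omega> \<partial>M) = (\<integral>\<omega>. real_cond_exp M (\<G> T) (V T s0) \<omega> \<partial>M)"
      using real_cond_exp_int(2)[OF integrable_V] by simp
    also have "\<dots> \<le> (\<integral>\<omega>. \<phi> T (St T \<omega>) \<omega> \<partial>M)"
      using real_cond_exp_int(1)[OF integrable_V] int_\<phi>[of T] bellman
      by (intro integral_mono_AE) (auto simp: bellman_inequalities_def St_def state_initial)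
    finally show ?thesis .
  qed
  have "(\<integral>\<omega>. \<phi> T (St T \<omega>) \<omega> \<partial>M) - (\<integral>\<omega>. \<phi> 0 (St 0 \<omega>) \<omega> \<partial>M) - (\<integral>\<omega>. (\<Sum>t=1..T. \<rho> t \<omega>) \<partial>M)
      \<le> (\<integral>\<omega>. (\<Sum>t=1..T. l t \<omega>) \<partial>M)"
  proof (rule expected_rewards_lower_bound[where C = C and B = B])
    fix t assume t: "t \<in> {1..T}"
    show "\<rho> t \<in> borel_measurable M"
      using reward_M[OF t] unfolding \<rho>_def[abs_def] by simp
    show "AE \<omega> in M. \<rho> t \<omega> \<le> B"
      using feasible t by (auto elim: eventually_mono)
  qed (fact integrable_\<phi> C int_l step)+
  moreover have "(\<integral>\<omega>. \<phi> 0 (St 0 \<omega>) \<omega> \<partial>M) = 0"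
    using Bochner_Integration.integral_cong[OF refl \<phi>_0, of M] by simp
  moreover have "expected_regret M T s0 \<xi> R Tr V Uhat
      = (\<integral>\<omega>. V T s0 \<omega> \<partial>M) - (\<integral>\<omega>. (\<Sum>t=1..T. \<rho> t \<omega>) \<partial>M)"
    by (simp add: expected_regret_def \<rho>_def A_def St_def)
  ultimately have first: "expected_regret M T s0 \<xi> R Tr V Uhat \<le> (\<integral>\<omega>. (\<Sum>t=1..T. l t \<omega>) \<partial>M)"
    using offline_le by simp

  have second: "(\<integral>\<omega>. (\<Sum>t=1..T. l t \<omega>) \<partial>M)
      \<le> (\<Sum>t=1..T. r * measure M (?Q t) + (\<integral>\<omega>. L t (St t \<omega>) \<omega> \<partial>M))"
    if nonneg: "AE \<omega> in M. \<forall>t \<in> {1..T}. \<forall>s \<in> space S. 0 \<le> L t s \<omega>"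
  proof -
    have "(\<integral>\<omega>. l t \<omega> \<partial>M) \<le> r * measure M (?Q t) + (\<integral>\<omega>. L t (St t \<omega>) \<omega> \<partial>M)"
      if t: "t \<in> {1..T}" for t
    proof -
      have "(\<integral>\<omega>. l t \<omega> \<partial>M) \<le> (\<integral>\<omega>. r * indicator (?Q t) \<omega> + L t (St t \<omega>) \<omega> \<partial>M)"
      proof (rule integral_mono_AE)
        show "AE \<omega> in M. l t \<omega> \<le> r * indicator (?Q t) \<omega> + L t (St t \<omega>) \<omega>"
          using nonneg AE_space
        proof eventually_elim
          case (elim \<omega>)
          then have "0 \<le> L t (St t \<omega>) \<omega>" using t St_space by blast
          then show ?case using elim by (simp add: l_def indicator_def)
        qed
      qed (use int_l int_Q integrable_L t in \<open>auto simp del: integrable_mult_right_iff\<close>)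
      also have "\<dots> = r * measure M (?Q t) + (\<integral>\<omega>. L t (St t \<omega>) \<omega> \<partial>M)"
        using int_Q[OF t] integrable_L[OF t] Q_sets[OF t]
        by (subst Bochner_Integration.integral_add) simp_all
      finally show ?thesis .
    qed
    then have "(\<Sum>t=1..T. \<integral>\<omega>. l t \<omega> \<partial>M)
        \<le> (\<Sum>t=1..T. r * measure M (?Q t) + (\<integral>\<omega>. L t (St t \<omega>) \<omega> \<partial>M))"
      by (rule sum_mono)
    then show ?thesis
      using int_l by simp
  qed
  show ?thesis
    using first second unfolding l_def by blast
qed

end
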